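(* For any context $\Gamma=(G,H)$ (as defined below), there is no infinite derivation (sequence of rule applications) from $\Gamma$ in the range analysis calculus.
   Context: Setting: formulas over sorts $\mathbb{F}_P$ ($P$ prime), $\mathbb{N}$ (with $+,\cdot$, truncated $-$, $\bmod$, $\le,\ge$, $\max$), $\mathrm{BV}_N$ and $\mathrm{Bool}$, with $\mathtt{ite}$ and conversions $\texttt{toNat}:\mathbb{F}_P\to\mathbb{N}$ (representative in $[0,P-1]$) and $\texttt{bvToNat}:\mathrm{BV}_N\to\mathbb{N}$. A context is $\Gamma=(G,H)$ with $G$ a finite set of goals ($\mathbb{N}$-inequalities) and $H$ a finite set of hypotheses; only $G$ is modified. Original variables are those occurring in $\Gamma$ before range analysis starts; placeholder variables $w,w_i$ are fresh variables introduced by the rules, implicitly existentially quantified over the goal set. $\mathrm{HasVars}(t)$ holds iff $t$ contains at least one variable and no placeholder variable; $\mathrm{twoOrigVars}(t)$ iff $t$ contains exactly two distinct non-placeholder variables; $\mathrm{hasSub}(t)$ iff $t$ contains $-_{\mathbb{N}}$. "Instantiate $w:=C$ using $\gamma$" means $G:=(G\setminus\{\gamma' \in G: w\text{ occurs in }\gamma'\})\cup\{\gamma'[w/C]:\gamma'\in G\setminus\{\gamma\}\}$. Rules ($t_i:\mathbb{N}$, $\gamma\in G$): introPVar: $\gamma\equiv t_1\bowtie t_2$, $\bowtie\in\{\le,\ge\}$, $\mathrm{HasVars}(t_1\bowtie t_2)$: replace $\gamma$ by $t_1\bowtie w$ and $t_2\bowtie' w$, where $\bowtie'$ is the other relation of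 $\{\le,\ge\}$. leqAddMul: $\gamma\equiv t_1\bowtie t_2\le w$, $\bowtie\in\{+,\cdot\}$, $\mathrm{HasVars}(t_1\bowtie t_2)$: replace by $t_1\le w_1$, $t_2\le w_2$, $w_1\bowtie w_2\le w$. leqSub: $\gamma\equiv t_1-t_2\le w$, $\mathrm{HasVars}(t_1-t_2)$: replace by $t_1\le w$. leqMod: $\gamma\equiv t_1\bmod t_2\le w$, $\mathrm{HasVars}(t_1\bmod t_2)$: replace by $t_2\le w$. leqIf: $\gamma\equiv\mathtt{ite}(c,t_1,t_2)\le w$ with $c$ Boolean, $\mathrm{HasVars}(t_1)$, $\mathrm{HasVars}(t_2)$: replace by $t_1\le w_1$, $t_2\le w_2$, $\max(w_1,w_2)\le w$. ineqHyp: $\gamma\equiv t_1\bowtie w$, $\bowtie\in\{\le,\ge\}$, $\mathrm{HasVars}(t_1)$, $t_1\bowtie C\in H$ for a constant $C$: instantiate $w:=C$. leqZMod: $\gamma\equiv\texttt{toNat}(v)\le w$, $v:\mathbb{F}_P$ not a placeholder: instantiate $w:=P-1$. leqBV: $\gamma\equiv\texttt{bvToNat}(v)\le w$, $v:\mathrm{BV}_N$ not a placeholder: instantiate $w:=2^N-1$. geNat: $\gamma\equiv t_1\ge w$, $\mathrm{HasVars}(t_1)$: instantiate $w:=0$. ineqConst: $\gamma\equiv C\bowtie w$, $C$ constant, and every $\gamma'\in G$ either does not contain $w$ or contains no original variable: instantiate $w:=C$. eval: $\gamma\equiv C_1\le C_2$ with constants: replace $\gamma$ by its evaluation. ineqCases: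 $\gamma\equiv t_1\bowtie t_2$, $\bowtie\in\{\le,\ge\}$, $\mathrm{twoOrigVars}(\gamma)$ with its two original variables $v_1,v_2$, $\mathrm{hasSub}(\gamma)$ or ($\mathrm{HasVars}(t_1)$ and $\mathrm{HasVars}(t_2)$), and $v_1\le1\in H$, $v_2\le1\in H$: replace $\gamma$ by the four goals $\gamma[v_1,v_2/a,b]$ for $(a,b)\in\{0,1\}^2$. ineqXOR: $\gamma\equiv v_1\cdot t_1+(1-v_1)\cdot t_2\bowtie w$, $\bowtie\in\{\le,\ge\}$, $v_1\le1\in H$: replace by $\mathtt{ite}(v_1=0,t_2,t_1)\bowtie w$. *)

theory Defs
  imports "HOL-Computational_Algebra.Primes"
begin

datatype sort = SField nat | SNat | SBV nat | SBool

type_synonym var = "string \<times> sort"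

text \<open>
  Terms and formulas share one syntax, with formulas being the terms of sort \<open>SBool\<close>.  The
  operations on natural numbers, \<open>ite\<close>, equality, the Boolean connectives, literals and the two
  conversions are explicit.  All other operations (field arithmetic, bit-vector operations and
  predicates, ...) are symbols of an arbitrary type \<open>'f\<close>, whose ranks and interpretation are
  parameters.
\<close>

datatype 'f trm =
    Var var
  | FLit nat nat  \<comment> \<open>modulus, representative\<close>
  | NLit nat
  | BVLit nat nat  \<comment> \<open>width, unsigned value\<close>
  | BLit bool
  | NAdd "'f trm" "'f trm"
  | NMul "'f trm" "'f trm"
  | NSub "'f trm" "'f trm"
  | NMod "'f trm" "'f trm"
  | NMax "'f trm" "'f trm"
  | NLe "'f trm" "'f trm"
  | NGe "'f trm" "'f trm"
  | Eq "'f trm" "'f trm"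
  | Neg "'f trm"
  | Conj "'f trm" "'f trm"
  | Disj "'f trm" "'f trm"
  | Ite "'f trm" "'f trm" "'f trm"
  | ToNat "'f trm"
  | BvToNat "'f trm"
  | Op 'f "'f trm list"

primrec sort_ok :: "sort \<Rightarrow> bool" where
  "sort_ok (SField P) = prime P"
| "sort_ok SNat = True"
| "sort_ok (SBV N) = True"
| "sort_ok SBool = True"

inductive has_sort :: "('f \<Rightarrow> sort list \<times> sort) \<Rightarrow> 'f trm \<Rightarrow> sort \<Rightarrow> bool"
  for rk :: "'f \<Rightarrow> sort list \<times> sort" where
  "sort_ok s \<Longrightarrow> has_sort rk (Var (x, s)) s"
| "prime P \<Longrightarrow> c < P \<Longrightarrow> has_sort rk (FLit P c) (SField P)"
| "has_sort rk (NLit n) SNat"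
| "c < 2 ^ N \<Longrightarrow> has_sort rk (BVLit N c) (SBV N)"
| "has_sort rk (BLit b) SBool"
| "F \<in> {NAdd, NMul, NSub, NMod, NMax} \<Longrightarrow> has_sort rk t1 SNat \<Longrightarrow> has_sort rk t2 SNat
    \<Longrightarrow> has_sort rk (F t1 t2) SNat"
| "R \<in> {NLe, NGe} \<Longrightarrow> has_sort rk t1 SNat \<Longrightarrow> has_sort rk t2 SNat
    \<Longrightarrow> has_sort rk (R t1 t2) SBool"
| "has_sort rk t1 s \<Longrightarrow> has_sort rk t2 s \<Longrightarrow> has_sort rk (Eq t1 t2) SBool"
| "has_sort rk t SBool \<Longrightarrow> has_sort rk (Neg t) SBool"
| "F \<in> {Conj, Disj} \<Longrightarrow> has_sort rk t1 SBool \<Longrightarrow> has_sort rk t2 SBool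
    \<Longrightarrow> has_sort rk (F t1 t2) SBool"
| "has_sort rk c SBool \<Longrightarrow> has_sort rk t1 s \<Longrightarrow> has_sort rk t2 s \<Longrightarrow> has_sort rk (Ite c t1 t2) s"
| "has_sort rk t (SField P) \<Longrightarrow> has_sort rk (ToNat t) SNat"
| "has_sort rk t (SBV N) \<Longrightarrow> has_sort rk (BvToNat t) SNat"
| "rk f = (ss, s) \<Longrightarrow> list_all2 (has_sort rk) ts ss \<Longrightarrow> has_sort rk (Op f ts) s"

text \<open>
  Elements of \<open>\<F>\<^sub>P\<close> and of \<open>BV\<^sub>N\<close> are represented by their natural number representatives, so
  both conversions to natural numbers are interpreted as the identity.
\<close>

datatype val = NumV (num_of: nat) | BoolV (truth_of: bool)

primrec carrier_of :: "sort \<Rightarrow> val set" where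
  "carrier_of (SField P) = NumV ` {..<P}"
| "carrier_of SNat = range NumV"
| "carrier_of (SBV N) = NumV ` {..<2 ^ N}"
| "carrier_of SBool = range BoolV"

text \<open>The additional symbols respect sorts and do not extend the operations with values in the
  natural numbers.\<close>

definition valid_signature ::
    "('f \<Rightarrow> sort list \<times> sort) \<Rightarrow> ('f \<Rightarrow> val list \<Rightarrow> val) \<Rightarrow> bool" where
  "valid_signature rk I \<longleftrightarrow>
     (\<forall>f ss s. rk f = (ss, s) \<longrightarrow>
        s \<noteq> SNat \<and> sort_ok s \<and> (\<forall>s'\<in>set ss. sort_ok s') \<and>
        (\<forall>vs. list_all2 (\<lambda>v s'. v \<in> carrier_of s') vs ss \<longrightarrow> I f vs \<in> carrier_of s))"

primrec denote :: "('f \<Rightarrow> val list \<Rightarrow> val) \<Rightarrow> (var \<Rightarrow> val) \<Rightarrow> 'f trm \<Rightarrow> val" where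
  "denote I \<rho> (Var x) = \<rho> x"
| "denote I \<rho> (FLit P c) = NumV c"
| "denote I \<rho> (NLit n) = NumV n"
| "denote I \<rho> (BVLit N c) = NumV c"
| "denote I \<rho> (BLit b) = BoolV b"
| "denote I \<rho> (NAdd s t) = NumV (num_of (denote I \<rho> s) + num_of (denote I \<rho> t))"
| "denote I \<rho> (NMul s t) = NumV (num_of (denote I \<rho> s) * num_of (denote I \<rho> t))"
| "denote I \<rho> (NSub s t) = NumV (num_of (denote I \<rho> s) - num_of (denote I \<rho> t))"
| "denote I \<rho> (NMod s t) = NumV (num_of (denote I \<rho> s) mod num_of (denote I \<rho> t))"
| "denote I \<rho> (NMax s t) = NumV (max (num_of (denote I \<rho> s)) (num_of (denote I \<rho> t)))"
| "denote I \<rho> (NLe s t) = BoolV (num_of (denote I \<rho> s) \<le> num_of (denote I \<rho> t))"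
| "denote I \<rho> (NGe s t) = BoolV (num_of (denote I \<rho> s) \<ge> num_of (denote I \<rho> t))"
| "denote I \<rho> (Eq s t) = BoolV (denote I \<rho> s = denote I \<rho> t)"
| "denote I \<rho> (Neg t) = BoolV (\<not> truth_of (denote I \<rho> t))"
| "denote I \<rho> (Conj s t) = BoolV (truth_of (denote I \<rho> s) \<and> truth_of (denote I \<rho> t))"
| "denote I \<rho> (Disj s t) = BoolV (truth_of (denote I \<rho> s) \<or> truth_of (denote I \<rho> t))"
| "denote I \<rho> (Ite c s t) = (if truth_of (denote I \<rho> c) then denote I \<rho> s else denote I \<rho> t)"
| "denote I \<rho> (ToNat t) = denote I \<rho> t"
| "denote I \<rho> (BvToNat t) = denote I \<rho> t"
| "denote I \<rho> (Op f ts) = I f (map (denote I \<rho>) ts)"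

primrec vars :: "'f trm \<Rightarrow> var set" where
  "vars (Var x) = {x}"
| "vars (FLit P c) = {}"
| "vars (NLit n) = {}"
| "vars (BVLit N c) = {}"
| "vars (BLit b) = {}"
| "vars (NAdd s t) = vars s \<union> vars t"
| "vars (NMul s t) = vars s \<union> vars t"
| "vars (NSub s t) = vars s \<union> vars t"
| "vars (NMod s t) = vars s \<union> vars t"
| "vars (NMax s t) = vars s \<union> vars t"
| "vars (NLe s t) = vars s \<union> vars t"
| "vars (NGe s t) = vars s \<union> vars t"
| "vars (Eq s t) = vars s \<union> vars t"
| "vars (Neg t) = vars t"
| "vars (Conj s t) = vars s \<union> vars t"
| "vars (Disj s t) = vars s \<union> vars t"
| "vars (Ite c s t) = vars c \<union> vars s \<union> vars t"
| "vars (ToNat t) = vars t"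
| "vars (BvToNat t) = vars t"
| "vars (Op f ts) = \<Union> (set (map vars ts))"

primrec has_sub :: "'f trm \<Rightarrow> bool" where
  "has_sub (Var x) = False"
| "has_sub (FLit P c) = False"
| "has_sub (NLit n) = False"
| "has_sub (BVLit N c) = False"
| "has_sub (BLit b) = False"
| "has_sub (NAdd s t) = (has_sub s \<or> has_sub t)"
| "has_sub (NMul s t) = (has_sub s \<or> has_sub t)"
| "has_sub (NSub s t) = True"
| "has_sub (NMod s t) = (has_sub s \<or> has_sub t)"
| "has_sub (NMax s t) = (has_sub s \<or> has_sub t)"
| "has_sub (NLe s t) = (has_sub s \<or> has_sub t)"
| "has_sub (NGe s t) = (has_sub s \<or> has_sub t)"
| "has_sub (Eq s t) = (has_sub s \<or> has_sub t)"
| "has_sub (Neg t) = has_sub t"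
| "has_sub (Conj s t) = (has_sub s \<or> has_sub t)"
| "has_sub (Disj s t) = (has_sub s \<or> has_sub t)"
| "has_sub (Ite c s t) = (has_sub c \<or> has_sub s \<or> has_sub t)"
| "has_sub (ToNat t) = has_sub t"
| "has_sub (BvToNat t) = has_sub t"
| "has_sub (Op f ts) = (True \<in> set (map has_sub ts))"

primrec subst :: "(var \<Rightarrow> 'f trm) \<Rightarrow> 'f trm \<Rightarrow> 'f trm" where
  "subst \<sigma> (Var x) = \<sigma> x"
| "subst \<sigma> (FLit P c) = FLit P c"
| "subst \<sigma> (NLit n) = NLit n"
| "subst \<sigma> (BVLit N c) = BVLit N c"
| "subst \<sigma> (BLit b) = BLit b"
| "subst \<sigma> (NAdd s t) = NAdd (subst \<sigma> s) (subst \<sigma> t)"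
| "subst \<sigma> (NMul s t) = NMul (subst \<sigma> s) (subst \<sigma> t)"
| "subst \<sigma> (NSub s t) = NSub (subst \<sigma> s) (subst \<sigma> t)"
| "subst \<sigma> (NMod s t) = NMod (subst \<sigma> s) (subst \<sigma> t)"
| "subst \<sigma> (NMax s t) = NMax (subst \<sigma> s) (subst \<sigma> t)"
| "subst \<sigma> (NLe s t) = NLe (subst \<sigma> s) (subst \<sigma> t)"
| "subst \<sigma> (NGe s t) = NGe (subst \<sigma> s) (subst \<sigma> t)"
| "subst \<sigma> (Eq s t) = Eq (subst \<sigma> s) (subst \<sigma> t)"
| "subst \<sigma> (Neg t) = Neg (subst \<sigma> t)"
| "subst \<sigma> (Conj s t) = Conj (subst \<sigma> s) (subst \<sigma> t)"
| "subst \<sigma> (Disj s t) = Disj (subst \<sigma> s) (subst \<sigma> t)"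
| "subst \<sigma> (Ite c s t) = Ite (subst \<sigma> c) (subst \<sigma> s) (subst \<sigma> t)"
| "subst \<sigma> (ToNat t) = ToNat (subst \<sigma> t)"
| "subst \<sigma> (BvToNat t) = BvToNat (subst \<sigma> t)"
| "subst \<sigma> (Op f ts) = Op f (map (subst \<sigma>) ts)"

text \<open>A constant is a variable-free term, not just a literal: instantiation produces goals such as
  \<open>3 + 5 \<le> w\<close>, whose left-hand side has to count as a constant.\<close>

definition is_const :: "'f trm \<Rightarrow> bool" where
  "is_const t \<longleftrightarrow> vars t = {}"

type_synonym 'f ctxt = "'f trm set \<times> 'f trm set"

definition is_context :: "('f \<Rightarrow> sort list \<times> sort) \<Rightarrow> 'f ctxt \<Rightarrow> bool" where
  "is_context rk \<Gamma> \<longleftrightarrow> (case \<Gamma> of (G, H) \<Rightarrow>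
     finite G \<and> finite H \<and>
     (\<forall>\<gamma>\<in>G. \<exists>R\<in>{NLe, NGe}. \<exists>t1 t2. \<gamma> = R t1 t2 \<and> has_sort rk t1 SNat \<and> has_sort rk t2 SNat) \<and>
     (\<forall>h\<in>H. has_sort rk h SBool))"

definition ctxt_vars :: "'f ctxt \<Rightarrow> var set" where
  "ctxt_vars \<Gamma> = (case \<Gamma> of (G, H) \<Rightarrow> \<Union> (vars ` G) \<union> \<Union> (vars ` H))"

text \<open>
  Below, \<open>V\<close> is the set of original variables, that is, those of the context from which the
  derivation starts.  Every other variable occurring in a derivation is a placeholder.
\<close>

definition placeholder :: "var set \<Rightarrow> var \<Rightarrow> bool" where
  "placeholder V x \<longleftrightarrow> x \<notin> V"

definition HasVars :: "var set \<Rightarrow> 'f trm \<Rightarrow> bool" where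
  "HasVars V t \<longleftrightarrow> vars t \<noteq> {} \<and> (\<forall>x\<in>vars t. \<not> placeholder V x)"

definition origVars :: "var set \<Rightarrow> 'f trm \<Rightarrow> var set" where
  "origVars V t = {x \<in> vars t. \<not> placeholder V x}"

definition twoOrigVars :: "var set \<Rightarrow> 'f trm \<Rightarrow> bool" where
  "twoOrigVars V t \<longleftrightarrow> card (origVars V t) = 2"

definition fresh :: "var set \<Rightarrow> 'f ctxt \<Rightarrow> var \<Rightarrow> bool" where
  "fresh V \<Gamma> w \<longleftrightarrow> snd w = SNat \<and> w \<notin> V \<and> w \<notin> ctxt_vars \<Gamma>"

definition replace :: "'f trm set \<Rightarrow> 'f trm \<Rightarrow> 'f trm set \<Rightarrow> 'f trm set" where
  "replace G \<gamma> D = (G - {\<gamma>}) \<union> D"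

definition instantiate :: "'f trm set \<Rightarrow> 'f trm \<Rightarrow> var \<Rightarrow> 'f trm \<Rightarrow> 'f trm set" where
  "instantiate G \<gamma> w C =
     (G - {\<gamma>' \<in> G. w \<in> vars \<gamma>'}) \<union> {subst (Var(w := C)) \<gamma>' |\<gamma>'. \<gamma>' \<in> G - {\<gamma>}}"

inductive range_step ::
    "('f \<Rightarrow> val list \<Rightarrow> val) \<Rightarrow> var set \<Rightarrow> 'f ctxt \<Rightarrow> 'f ctxt \<Rightarrow> bool"
  for I :: "'f \<Rightarrow> val list \<Rightarrow> val" and V :: "var set" where
  introPVar:
    "\<lbrakk>\<gamma> \<in> G; \<gamma> = R t1 t2; (R, R') \<in> {(NLe, NGe), (NGe, NLe)}; HasVars V \<gamma>; fresh V (G, H) w\<rbrakk>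
     \<Longrightarrow> range_step I V (G, H) (replace G \<gamma> {R t1 (Var w), R' t2 (Var w)}, H)"
| leqAddMul:
    "\<lbrakk>\<gamma> \<in> G; \<gamma> = NLe (F t1 t2) (Var w); placeholder V w; F \<in> {NAdd, NMul}; HasVars V (F t1 t2);
      fresh V (G, H) w1; fresh V (G, H) w2; w1 \<noteq> w2\<rbrakk>
     \<Longrightarrow> range_step I V (G, H)
          (replace G \<gamma> {NLe t1 (Var w1), NLe t2 (Var w2), NLe (F (Var w1) (Var w2)) (Var w)}, H)"
| leqSub:
    "\<lbrakk>\<gamma> \<in> G; \<gamma> = NLe (NSub t1 t2) (Var w); placeholder V w; HasVars V (NSub t1 t2)\<rbrakk>
     \<Longrightarrow> range_step I V (G, H) (replace G \<gamma> {NLe t1 (Var w)}, H)"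
| leqMod:
    "\<lbrakk>\<gamma> \<in> G; \<gamma> = NLe (NMod t1 t2) (Var w); placeholder V w; HasVars V (NMod t1 t2)\<rbrakk>
     \<Longrightarrow> range_step I V (G, H) (replace G \<gamma> {NLe t2 (Var w)}, H)"
| leqIf:
    "\<lbrakk>\<gamma> \<in> G; \<gamma> = NLe (Ite c t1 t2) (Var w); placeholder V w; HasVars V t1; HasVars V t2;
      fresh V (G, H) w1; fresh V (G, H) w2; w1 \<noteq> w2\<rbrakk>
     \<Longrightarrow> range_step I V (G, H)
          (replace G \<gamma> {NLe t1 (Var w1), NLe t2 (Var w2), NLe (NMax (Var w1) (Var w2)) (Var w)}, H)"
| ineqHyp:
    "\<lbrakk>\<gamma> \<in> G; \<gamma> = R t1 (Var w); placeholder V w; R \<in> {NLe, NGe}; HasVars V t1;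
      R t1 C \<in> H; is_const C\<rbrakk>
     \<Longrightarrow> range_step I V (G, H) (instantiate G \<gamma> w C, H)"
| leqZMod:
    "\<lbrakk>\<gamma> \<in> G; \<gamma> = NLe (ToNat (Var v)) (Var w); placeholder V w; snd v = SField P;
      \<not> placeholder V v\<rbrakk>
     \<Longrightarrow> range_step I V (G, H) (instantiate G \<gamma> w (NLit (P - 1)), H)"
| leqBV:
    "\<lbrakk>\<gamma> \<in> G; \<gamma> = NLe (BvToNat (Var v)) (Var w); placeholder V w; snd v = SBV N;
      \<not> placeholder V v\<rbrakk>
     \<Longrightarrow> range_step I V (G, H) (instantiate G \<gamma> w (NLit (2 ^ N - 1)), H)"
| geNat:
    "\<lbrakk>\<gamma> \<in> G; \<gamma> = NGe t1 (Var w); placeholder V w; HasVars V t1\<rbrakk>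
     \<Longrightarrow> range_step I V (G, H) (instantiate G \<gamma> w (NLit 0), H)"
| ineqConst:
    "\<lbrakk>\<gamma> \<in> G; \<gamma> = R C (Var w); placeholder V w; R \<in> {NLe, NGe}; is_const C;
      \<forall>\<gamma>'\<in>G. w \<notin> vars \<gamma>' \<or> origVars V \<gamma>' = {}\<rbrakk>
     \<Longrightarrow> range_step I V (G, H) (instantiate G \<gamma> w C, H)"
| evalConst:  \<comment> \<open>\<open>\<rho>\<close> is irrelevant, as \<open>\<gamma>\<close> has no variables\<close>
    "\<lbrakk>\<gamma> \<in> G; \<gamma> = NLe C1 C2; is_const C1; is_const C2\<rbrakk>
     \<Longrightarrow> range_step I V (G, H) (replace G \<gamma> {BLit (truth_of (denote I \<rho> \<gamma>))}, H)"
| ineqCases: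
    "\<lbrakk>\<gamma> \<in> G; \<gamma> = R t1 t2; R \<in> {NLe, NGe}; twoOrigVars V \<gamma>; origVars V \<gamma> = {v1, v2};
      has_sub \<gamma> \<or> HasVars V t1 \<and> HasVars V t2;
      NLe (Var v1) (NLit 1) \<in> H; NLe (Var v2) (NLit 1) \<in> H\<rbrakk>
     \<Longrightarrow> range_step I V (G, H)
          (replace G \<gamma> {subst (Var(v1 := NLit a, v2 := NLit b)) \<gamma> |a b. a \<in> {0, 1} \<and> b \<in> {0, 1}}, H)"
| ineqXOR:
    "\<lbrakk>\<gamma> \<in> G; \<gamma> = R (NAdd (NMul (Var v1) t1) (NMul (NSub (NLit 1) (Var v1)) t2)) (Var w);
      placeholder V w; R \<in> {NLe, NGe}; NLe (Var v1) (NLit 1) \<in> H\<rbrakk>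
     \<Longrightarrow> range_step I V (G, H) (replace G \<gamma> {R (Ite (Eq (Var v1) (NLit 0)) t2 t1) (Var w)}, H)"

definition infinite_derivation ::
    "('f \<Rightarrow> val list \<Rightarrow> val) \<Rightarrow> 'f ctxt \<Rightarrow> (nat \<Rightarrow> 'f ctxt) \<Rightarrow> bool" where
  "infinite_derivation I \<Gamma> S \<longleftrightarrow>
     S 0 = \<Gamma> \<and> (\<forall>i. range_step I (ctxt_vars \<Gamma>) (S i) (S (Suc i)))"

end

theory Submission
  imports Defs
begin

text \<open>
  Every rule application decreases, lexicographically, the following three numbers.  First, the
  number of arithmetic nodes and variable leaves that depend on an original variable, summed over
  all goals: it ignores placeholders and constants, so it never increases under instantiation, and
  every rule except introPVar, ineqConst and eval strictly decreases it.  Second, the number of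
  goals that contain original variables only, which introPVar decreases; the side condition of
  ineqConst is exactly what prevents that rule from creating such a goal.  Third, the number of
  goals that are not Boolean literals, which ineqConst and eval decrease.
\<close>

section \<open>Weights of terms\<close>

text \<open>Keeping 0 fixed makes terms without original variables weightless, while peeling off a
  node above an original variable loses at least 1.\<close>

definition bump :: "nat \<Rightarrow> nat" where
  "bump n = (if n = 0 then 0 else Suc n)"

text \<open>Comparisons only add up the weights of their two sides, so that introPVar preserves the total
  weight.\<close>

primrec weight :: "var set \<Rightarrow> 'f trm \<Rightarrow> nat" where
  "weight V (Var x) = (if x \<in> V then 1 else 0)"
| "weight V (FLit P c) = 0"
| "weight V (NLit n) = 0"
| "weight V (BVLit N c) = 0"
| "weight V (BLit b) = 0"
| "weight V (NAdd s t) = bump (weight V s + weight V t)"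
| "weight V (NMul s t) = bump (weight V s + weight V t)"
| "weight V (NSub s t) = bump (weight V s + weight V t)"
| "weight V (NMod s t) = bump (weight V s + weight V t)"
| "weight V (NMax s t) = weight V s + weight V t"
| "weight V (NLe s t) = weight V s + weight V t"
| "weight V (NGe s t) = weight V s + weight V t"
| "weight V (Eq s t) = weight V s + weight V t"
| "weight V (Neg t) = weight V t"
| "weight V (Conj s t) = weight V s + weight V t"
| "weight V (Disj s t) = weight V s + weight V t"
| "weight V (Ite c s t) = bump (weight V c + weight V s + weight V t)"
| "weight V (ToNat t) = weight V t"
| "weight V (BvToNat t) = weight V t"
| "weight V (Op f ts) = sum_list (map (weight V) ts)"

lemma weight_eq_0_iff: "weight V t = 0 \<longleftrightarrow> vars t \<inter> V = {}"
  by (induction t) (auto simp: bump_def split: if_splits)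

lemma HasVars_weight_pos: "HasVars V t \<Longrightarrow> 0 < weight V t"
  using weight_eq_0_iff[of V t] by (fastforce simp: HasVars_def placeholder_def)

lemma origVars_weight_pos: "origVars V t \<noteq> {} \<Longrightarrow> 0 < weight V t"
  using weight_eq_0_iff[of V t] by (fastforce simp: origVars_def placeholder_def)

text \<open>The replaced leaves and the constant both weigh 0, so every \<open>bump\<close> sees the
  same argument before and after.\<close>

lemma weight_subst_const:
  assumes "w \<notin> V" "is_const C"
  shows "weight V (subst (Var(w := C)) t) = weight V t"
proof -
  have "weight V C = 0"
    using assms by (simp add: weight_eq_0_iff is_const_def)
  with assms(1) show ?thesis
    by (induction t) (auto simp: comp_def cong: map_cong)
qed

lemma vars_subst: "vars (subst \<sigma> t) = (\<Union>x\<in>vars t. vars (\<sigma> x))"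
  by (induction t) auto

lemma subst_trivial: "(\<And>x. x \<in> vars t \<Longrightarrow> \<sigma> x = Var x) \<Longrightarrow> subst \<sigma> t = t"
  by (induction t) (simp_all, metis map_idI)

text \<open>Goals without \<open>w\<close> are fixed by the substitution, so the goals that are kept
  already lie in the image. Instantiation thus is a single map on the remaining goals.\<close>

lemma instantiate_eq_image:
  assumes "\<gamma> \<in> G" "w \<in> vars \<gamma>"
  shows "instantiate G \<gamma> w C = subst (Var(w := C)) ` (G - {\<gamma>})"
proof -
  have "subst (Var(w := C)) \<gamma>' = \<gamma>'" if "w \<notin> vars \<gamma>'" for \<gamma>' :: "'a trm"
    using that by (intro subst_trivial) auto
  then have "G - {\<gamma>' \<in> G. w \<in> vars \<gamma>'} \<subseteq> subst (Var(w := C)) ` (G - {\<gamma>})"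
    using assms(2) by (intro subsetI) (metis (lifting) DiffE DiffI image_eqI mem_Collect_eq singletonD)
  then show ?thesis
    unfolding instantiate_def by blast
qed

section \<open>The rank of a goal set\<close>

definition total_weight :: "var set \<Rightarrow> 'f trm set \<Rightarrow> nat" where
  "total_weight V G = (\<Sum>\<gamma>\<in>G. weight V \<gamma>)"

definition pure_goals :: "var set \<Rightarrow> 'f trm set \<Rightarrow> 'f trm set" where
  "pure_goals V G = {\<gamma> \<in> G. HasVars V \<gamma>}"

text \<open>Evaluated goals stay in the goal set as Boolean literals, which no rule acts on and no
  substitution changes; they must not be counted.\<close>

definition open_goals :: "'f trm set \<Rightarrow> 'f trm set" where
  "open_goals G = {\<gamma> \<in> G. \<gamma> \<notin> range BLit}"

definition step_order :: "((nat \<times> nat \<times> nat) \<times> (nat \<times> nat \<times> nat)) set" where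
  "step_order = less_than <*lex*> less_than <*lex*> less_than"

definition rank :: "var set \<Rightarrow> 'f trm set \<Rightarrow> nat \<times> nat \<times> nat" where
  "rank V G = (total_weight V G, card (pure_goals V G), card (open_goals G))"

lemma rank_less:
  assumes "total_weight V G' \<le> total_weight V G"
    and "total_weight V G' < total_weight V G
      \<or> card (pure_goals V G') < card (pure_goals V G)
      \<or> card (pure_goals V G') \<le> card (pure_goals V G) \<and> card (open_goals G') < card (open_goals G)"
  shows "(rank V G', rank V G) \<in> step_order"
  using assms by (auto simp: rank_def step_order_def)

section \<open>Effect of replacement and instantiation on the rank\<close>

lemma total_weight_remove:
  "finite G \<Longrightarrow> \<gamma> \<in> G \<Longrightarrow> total_weight V G = weight V \<gamma> + total_weight V (G - {\<gamma>})"
  unfolding total_weight_def by (rule sum.remove)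

text \<open>Only an inequality, since members of \<open>D\<close> may already be goals; additive on
  both sides to avoid truncated subtraction.\<close>

lemma total_weight_replace:
  assumes "finite G" "\<gamma> \<in> G" "finite D"
  shows "total_weight V (replace G \<gamma> D) + weight V \<gamma> \<le> total_weight V G + total_weight V D"
proof -
  have "total_weight V (replace G \<gamma> D) \<le> total_weight V (G - {\<gamma>}) + total_weight V D"
    using assms unfolding total_weight_def replace_def by (simp add: sum_Un_nat)
  with total_weight_remove[OF assms(1,2), of V] show ?thesis by linarith
qed

text \<open>The substitution preserves each weight but may make goals coincide, so beyond the loss
  of \<open>\<gamma>\<close> the sum can only drop.\<close>

lemma total_weight_instantiate:
  assumes "finite G" "\<gamma> \<in> G" "w \<in> vars \<gamma>" "w \<notin> V" "is_const C"
  shows "total_weight V (instantiate G \<gamma> w C) + weight V \<gamma> \<le> total_weight V G"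
proof -
  have "total_weight V (instantiate G \<gamma> w C) \<le> (\<Sum>\<gamma>'\<in>G - {\<gamma>}. weight V (subst (Var(w := C)) \<gamma>'))"
    using assms(1) unfolding instantiate_eq_image[OF assms(2,3)] total_weight_def
    by (intro sum_image_le[where g = "weight V", unfolded comp_def]) auto
  also have "\<dots> = total_weight V (G - {\<gamma>})"
    by (simp add: total_weight_def weight_subst_const assms(4,5))
  finally show ?thesis
    using total_weight_remove[OF assms(1,2), of V] by linarith
qed

lemma total_weight_insert_le:
  "finite D \<Longrightarrow> total_weight V (insert \<gamma> D) \<le> weight V \<gamma> + total_weight V D"
  by (cases "\<gamma> \<in> D") (auto simp: total_weight_def insert_absorb)

lemma total_weight_triple_le:
  "total_weight V {a, b, c} \<le> weight V a + weight V b + weight V c"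
  using total_weight_insert_le[of "{b, c}" V a] total_weight_insert_le[of "{c}" V b]
  by (simp add: total_weight_def)

lemma replace_rank_less:
  assumes "finite G" "\<gamma> \<in> G" "finite D" "total_weight V D < weight V \<gamma>"
  shows "(rank V (replace G \<gamma> D), rank V G) \<in> step_order"
  using total_weight_replace[OF assms(1-3), of V] assms(4) by (intro rank_less) auto

lemma instantiate_rank_less:
  assumes "finite G" "\<gamma> \<in> G" "w \<in> vars \<gamma>" "placeholder V w" "is_const C" "0 < weight V \<gamma>"
  shows "(rank V (instantiate G \<gamma> w C), rank V G) \<in> step_order"
  using total_weight_instantiate[of G \<gamma> w V C] assms
  by (intro rank_less) (auto simp: placeholder_def)

text \<open>By the side condition \<open>\<gamma>\<close> itself weighs 0, so the total weight need
  not drop and the other two components decide.\<close>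

lemma instantiate_const_rank_less:
  assumes "finite G" "\<gamma> \<in> G" "w \<in> vars \<gamma>" "placeholder V w" "is_const C" "\<gamma> \<notin> range BLit"
    and no_orig: "\<forall>\<gamma>'\<in>G. w \<notin> vars \<gamma>' \<or> origVars V \<gamma>' = {}"
  shows "(rank V (instantiate G \<gamma> w C), rank V G) \<in> step_order"
proof -
  let ?\<sigma> = "Var(w := C)"
  have image: "instantiate G \<gamma> w C = subst ?\<sigma> ` (G - {\<gamma>})"
    using assms(2,3) by (rule instantiate_eq_image)
  have "pure_goals V (instantiate G \<gamma> w C) \<subseteq> pure_goals V G"
  proof
    fix \<delta> assume "\<delta> \<in> pure_goals V (instantiate G \<gamma> w C)"
    then obtain \<gamma>' where \<gamma>': "\<gamma>' \<in> G" "\<delta> = subst ?\<sigma> \<gamma>'" and pure: "HasVars V \<delta>"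
      by (auto simp: image pure_goals_def)
    \<comment> \<open>Substitution preserves weight, so \<open>\<gamma>'\<close> contains an
      original variable; the side condition then keeps \<open>w\<close> out of it.\<close>
    have "0 < weight V \<gamma>'"
      using HasVars_weight_pos[OF pure] assms(4,5) \<gamma>'(2)
      by (simp add: weight_subst_const placeholder_def)
    then have "w \<notin> vars \<gamma>'"
      using no_orig \<gamma>'(1) weight_eq_0_iff[of V \<gamma>']
      by (auto simp: origVars_def placeholder_def)
    then have "\<delta> = \<gamma>'"
      unfolding \<gamma>'(2) by (intro subst_trivial) auto
    with \<gamma>'(1) pure show "\<delta> \<in> pure_goals V G"
      by (simp add: pure_goals_def)
  qed
  then have "card (pure_goals V (instantiate G \<gamma> w C)) \<le> card (pure_goals V G)"
    using assms(1) by (intro card_mono) (auto simp: pure_goals_def)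
  moreover have "card (open_goals (instantiate G \<gamma> w C)) < card (open_goals G)"
  proof -
    \<comment> \<open>Literals are mapped to themselves, so an open goal can only come from an open
      one.\<close>
    have "open_goals (instantiate G \<gamma> w C) \<subseteq> subst ?\<sigma> ` (open_goals G - {\<gamma>})"
      by (auto simp: image open_goals_def)
    then have "card (open_goals (instantiate G \<gamma> w C)) \<le> card (open_goals G - {\<gamma>})"
      using assms(1) by (intro surj_card_le) (auto simp: open_goals_def)
    also have "\<dots> < card (open_goals G)"
      using assms(1,2,6) by (intro card_Diff1_less) (auto simp: open_goals_def)
    finally show ?thesis .
  qed
  ultimately show ?thesis
    using total_weight_instantiate[of G \<gamma> w V C] assms(1-5)
    by (intro rank_less) (auto simp: placeholder_def)
qed

section \<open>Rule applications decrease the rank\<close>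

lemma finite_replace: "finite G \<Longrightarrow> finite D \<Longrightarrow> finite (replace G \<gamma> D)"
  by (simp add: replace_def)

lemma finite_instantiate: "finite G \<Longrightarrow> finite (instantiate G \<gamma> w C)"
  by (simp add: instantiate_def)

lemma case_split_finite: "finite {f a b |a b. a \<in> {0, 1 :: nat} \<and> b \<in> {0, 1 :: nat}}"
proof -
  have "{f a b |a b. a \<in> {0, 1 :: nat} \<and> b \<in> {0, 1 :: nat}} =
      (\<lambda>(a, b). f a b) ` ({0, 1} \<times> {0, 1})"
    by (auto simp: image_iff)
  then show ?thesis by simp
qed

lemma range_step_hyps_and_finite:
  assumes "range_step I V (G, H) (G', H')" "finite G"
  shows "H' = H \<and> finite G'"
  using assms(1)
  by cases (use assms(2) in
    \<open>simp_all only: finite_replace finite_instantiate case_split_finite finite.intros simp_thms\<close>)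

text \<open>\<open>ineqXOR\<close> does not itself demand that \<open>v1\<close> be original; this
  follows from its bound among the hypotheses, via \<open>hyps\<close>.\<close>

lemma range_step_rank_less:
  assumes "range_step I V (G, H) (G', H')" and fin: "finite G" and hyps: "\<Union> (vars ` H) \<subseteq> V"
  shows "(rank V G', rank V G) \<in> step_order"
  using assms(1)
proof cases
  case (introPVar \<gamma> R t1 t2 R' w)
  let ?D = "{R t1 (Var w), R' t2 (Var w)}"
  have w: "w \<notin> V" and pure: "HasVars V \<gamma>"
    using introPVar by (auto simp: fresh_def)
  have "total_weight V ?D \<le> weight V (R t1 (Var w)) + weight V (R' t2 (Var w))"
    using total_weight_insert_le[of "{R' t2 (Var w)}" V "R t1 (Var w)"]
    by (simp add: total_weight_def)
  also have "\<dots> = weight V \<gamma>"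
    using introPVar w by auto
  finally have weight: "total_weight V (replace G \<gamma> ?D) \<le> total_weight V G"
    using total_weight_replace[OF fin introPVar(3), of ?D V] by simp
  \<comment> \<open>Both new goals contain the placeholder \<open>w\<close>, so neither is
    pure.\<close>
  have "pure_goals V (replace G \<gamma> ?D) \<subseteq> pure_goals V G - {\<gamma>}"
    using introPVar w by (auto simp: pure_goals_def replace_def HasVars_def placeholder_def)
  moreover have "\<gamma> \<in> pure_goals V G" "finite (pure_goals V G)"
    using introPVar(3) pure fin by (auto simp: pure_goals_def)
  ultimately have "card (pure_goals V (replace G \<gamma> ?D)) < card (pure_goals V G)"
    by (intro psubset_card_mono) auto
  with weight show ?thesis
    unfolding introPVar(1) by (intro rank_less) auto
next
  case (leqAddMul \<gamma> F t1 t2 w w1 w2)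
  \<comment> \<open>In the new goals only \<open>t1\<close> and \<open>t2\<close> carry weight;
    positivity makes \<open>bump\<close> add 1 to the old goal.\<close>
  have "0 < weight V (F t1 t2)" "w \<notin> V" "w1 \<notin> V" "w2 \<notin> V"
    using leqAddMul HasVars_weight_pos[of V "F t1 t2"] by (auto simp: fresh_def placeholder_def)
  then show ?thesis
    unfolding leqAddMul(1) using leqAddMul fin
    by (intro replace_rank_less)
      (auto intro!: order.strict_trans1[OF total_weight_triple_le] simp: bump_def split: if_splits)
next
  case (leqSub \<gamma> t1 t2 w)
  \<comment> \<open>The lost \<open>bump\<close> gives a strict decrease even if \<open>t2\<close>
    weighs 0.\<close>
  then show ?thesis
    using HasVars_weight_pos[of V "NSub t1 t2"] fin
    by (auto intro!: replace_rank_less simp: total_weight_def bump_def split: if_splits)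
next
  case (leqMod \<gamma> t1 t2 w)
  then show ?thesis
    using HasVars_weight_pos[of V "NMod t1 t2"] fin
    by (auto intro!: replace_rank_less simp: total_weight_def bump_def split: if_splits)
next
  case (leqIf \<gamma> c t1 t2 w w1 w2)
  have "0 < weight V t1" "w \<notin> V" "w1 \<notin> V" "w2 \<notin> V"
    using leqIf HasVars_weight_pos[of V t1] by (auto simp: fresh_def placeholder_def)
  then show ?thesis
    unfolding leqIf(1) using leqIf fin
    by (intro replace_rank_less)
      (auto intro!: order.strict_trans1[OF total_weight_triple_le] simp: bump_def split: if_splits)
next
  case (ineqHyp \<gamma> R t1 w C)
  then show ?thesis
    using HasVars_weight_pos[of V t1] fin by (auto intro!: instantiate_rank_less)
next
  case (leqZMod \<gamma> v w P)
  then show ?thesis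
    using fin by (auto intro!: instantiate_rank_less simp: is_const_def placeholder_def)
next
  case (leqBV \<gamma> v w N)
  then show ?thesis
    using fin by (auto intro!: instantiate_rank_less simp: is_const_def placeholder_def)
next
  case (geNat \<gamma> t1 w)
  then show ?thesis
    using HasVars_weight_pos[of V t1] fin by (auto intro!: instantiate_rank_less simp: is_const_def)
next
  case (ineqConst \<gamma> R C w)
  then show ?thesis
    unfolding ineqConst(1) using fin by (intro instantiate_const_rank_less) auto
next
  case (evalConst \<gamma> C1 C2 \<rho>)
  let ?D = "{BLit (truth_of (denote I \<rho> \<gamma>))} :: 'a trm set"
  have "total_weight V (replace G \<gamma> ?D) \<le> total_weight V G"
    using total_weight_replace[OF fin evalConst(3), of ?D V] by (simp add: total_weight_def)
  moreover have "card (pure_goals V (replace G \<gamma> ?D)) \<le> card (pure_goals V G)"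
    using fin by (intro card_mono) (auto simp: pure_goals_def replace_def HasVars_def)
  moreover have "card (open_goals (replace G \<gamma> ?D)) < card (open_goals G)"
    using fin evalConst(3,4) by (intro psubset_card_mono) (auto simp: open_goals_def replace_def)
  ultimately show ?thesis
    unfolding evalConst(1) by (intro rank_less) auto
next
  case (ineqCases \<gamma> R t1 t2 v1 v2)
  let ?D = "{subst (Var(v1 := NLit a, v2 := NLit b)) \<gamma> |a b. a \<in> {0, 1} \<and> b \<in> {0, 1}}"
  \<comment> \<open>Both original variables of \<open>\<gamma>\<close> become literals, so none is
    left.\<close>
  have "weight V (subst (Var(v1 := NLit a, v2 := NLit b)) \<gamma>) = 0" for a b
    using ineqCases(7)
    by (auto simp: weight_eq_0_iff vars_subst origVars_def placeholder_def split: if_splits)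
  then have "total_weight V ?D = 0"
    unfolding total_weight_def by (intro sum.neutral ballI) (elim CollectE exE conjE, simp only:)
  moreover have "0 < weight V \<gamma>"
    using ineqCases(7) by (intro origVars_weight_pos) auto
  moreover have "finite ?D"
    by (rule case_split_finite)
  ultimately show ?thesis
    unfolding ineqCases(1) using fin ineqCases(3) by (intro replace_rank_less) auto
next
  case (ineqXOR \<gamma> R v1 t1 t2 w)
  \<comment> \<open>With \<open>v1\<close> of weight 1, the sum weighs 6 more than \<open>t1\<close>
    and \<open>t2\<close> together, the conditional only 2 more.\<close>
  have "v1 \<in> V"
    using ineqXOR hyps by force
  then show ?thesis
    using ineqXOR fin by (auto intro!: replace_rank_less simp: total_weight_def bump_def)
qed

theorem theorem3:
  fixes rk :: "'f \<Rightarrow> sort list \<times> sort"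
    and I :: "'f \<Rightarrow> val list \<Rightarrow> val"
    and \<Gamma> :: "'f ctxt"
  assumes "valid_signature rk I"
    and "is_context rk \<Gamma>"
  shows "\<not> (\<exists>S. infinite_derivation I \<Gamma> S)"
proof
  assume "\<exists>S. infinite_derivation I \<Gamma> S"
  then obtain S where S0: "S 0 = \<Gamma>"
    and "range_step I (ctxt_vars \<Gamma>) (S i) (S (Suc i))" for i
    by (auto simp: infinite_derivation_def)
  then have step: "range_step I (ctxt_vars \<Gamma>) (fst (S i), snd (S i))
      (fst (S (Suc i)), snd (S (Suc i)))" for i
    by simp
  \<comment> \<open>Unchanged hypotheses keep their variables original; finiteness matters because
    sums and cardinalities default to 0 on infinite sets.\<close>
  have inv: "snd (S i) = snd \<Gamma> \<and> finite (fst (S i))" for i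
  proof (induction i)
    case 0
    then show ?case
      using assms(2) by (auto simp: S0 is_context_def)
  next
    case (Suc i)
    then show ?case
      using range_step_hyps_and_finite[OF step[of i]] by metis
  qed
  have "\<Union> (vars ` snd \<Gamma>) \<subseteq> ctxt_vars \<Gamma>"
    by (auto simp: ctxt_vars_def split: prod.splits)
  then have "(rank (ctxt_vars \<Gamma>) (fst (S (Suc i))), rank (ctxt_vars \<Gamma>) (fst (S i))) \<in> step_order"
    for i
    using range_step_rank_less[OF step[of i]] inv[of i] by metis
  moreover have "wf step_order"
    by (simp add: step_order_def wf_lex_prod)
  ultimately show False
    unfolding wf_iff_no_infinite_down_chain
    by (elim notE) (rule exI[of _ "\<lambda>i. rank (ctxt_vars \<Gamma>) (fst (S i))"], blast)
qed

end
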